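(* Let $\lambda\in[0,\infty)$, $\phi\in(0,\infty)$, $\phi_s\in[\phi,\infty]$. For all $M=1,2,\dots$, $$\mathscr B^{\mathrm{sub}}_{\lambda,\infty}(\phi,\phi_s)\le\mathscr B^{\mathrm{sub}}_{\lambda,M+1}(\phi,\phi_s)\le\mathscr B^{\mathrm{sub}}_{\lambda,M}(\phi,\phi_s),$$ $$\mathscr V^{\mathrm{sub}}_{\lambda,\infty}(\phi,\phi_s)\le\mathscr V^{\mathrm{sub}}_{\lambda,M+1}(\phi,\phi_s)\le\mathscr V^{\mathrm{sub}}_{\lambda,M}(\phi,\phi_s).$$ The inequalities for $\mathscr B^{\mathrm{sub}}$ are strict whenever $\rho^2>0$ and $\phi_s\in(\phi,\infty)$ (and $\phi_s\ne1$ when $\lambda=0$), while the inequalities for $\mathscr V^{\mathrm{sub}}$ are strict when $\sigma^2>0$ and $\phi_s\in(\phi,\infty)$ (and $\phi_s\ne1$ when $\lambda=0$). Thus, the asymptotic risk is monotonically decreasing in $M$, i.e., $\mathscr R^{\mathrm{sub}}_{\lambda,\infty}(\phi,\phi_s)\le\mathscr R^{\mathrm{sub}}_{\lambda,M+1}(\phi,\phi_s)\le\mathscr R^{\mathrm{sub}}_{\lambda,M}(\phi,\phi_s)$.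
   Context: Let $0<r_{\min}\le r_{\max}<\infty$, let $H,G$ be probability measures supported on $[r_{\min},r_{\max}]$ (limiting spectral distribution of the feature covariance and limiting signal-weighted spectral distribution), and let $\rho^2,\sigma^2\ge0$ be finite (signal energy, noise variance). Here $\phi$ is the limiting ratio of number of features to number of observations, $\phi_s$ the limiting ratio of number of features to subsample size, and $M$ the number of bags; $\mathscr R^{\mathrm{sub}}_{\lambda,M}$ is the asymptotic prediction risk of the average of $M$ ridge (ridgeless if $\lambda=0$) predictors fitted on random subsamples, with bias and variance components $\mathscr B^{\mathrm{sub}}_{\lambda,M}$, $\mathscr V^{\mathrm{sub}}_{\lambda,M}$, defined as follows. For $\lambda>0,\theta\in(0,\infty)$, $v(-\lambda;\theta)$ is the unique nonnegative solution of $\frac1{v}=\lambda+\theta\int\frac{r}{1+vr}dH(r)$; $v(0;\theta)=\lim_{\lambda\to0^+}v(-\lambda;\theta)$ if $\theta>1$ and $+\infty$ if $\theta\in(0,1]$. With $v=v(-\lambda;\theta)$, $$\widetilde v(-\lambda;\vartheta,\theta)=\frac{\vartheta\int r^2(1+vr)^{-2}dH(r)}{v^{-2}-\vartheta\int r^2(1+vr)^{-2}dH(r)},\qquad \widetilde c(-\lambda;\theta)=\int\frac{r}{(1+vr)^2}dG(r).$$ At $\theta=\infty$: $v=0$, $\widetilde v=0$, $\widetilde c=\int r\,dG(r)$ (limits as $\theta\to\infty$). For $\vartheta\le\theta$, $B_\lambda(\vartheta,\theta)=\rho^2(1+\widetilde v(-\lambda;\vartheta,\theta))\widetilde c(-\lambda;\theta)$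 and $V_\lambda(\vartheta,\theta)=\sigma^2\widetilde v(-\lambda;\vartheta,\theta)$; for $\lambda=0$ and $\theta\le1$ these are read as $B_0(\vartheta,\theta)=0$ for $\theta\in(0,1]$, $V_0(\vartheta,\theta)=\sigma^2\vartheta/(1-\vartheta)$ for $\theta\in(0,1)$, and $V_0(\vartheta,1)=\infty$. For $M\in\mathbb N$: $\mathscr B^{\mathrm{sub}}_{\lambda,M}(\phi,\phi_s)=M^{-1}B_\lambda(\phi_s,\phi_s)+(1-M^{-1})B_\lambda(\phi,\phi_s)$, $\mathscr V^{\mathrm{sub}}_{\lambda,M}(\phi,\phi_s)=M^{-1}V_\lambda(\phi_s,\phi_s)+(1-M^{-1})V_\lambda(\phi,\phi_s)$; for $M=\infty$ they are $B_\lambda(\phi,\phi_s)$ and $V_\lambda(\phi,\phi_s)$. Finally $\mathscr R^{\mathrm{sub}}_{\lambda,M}=\sigma^2+\mathscr B^{\mathrm{sub}}_{\lambda,M}+\mathscr V^{\mathrm{sub}}_{\lambda,M}$.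
   Formalization: For λ=0, strictness of the bias inequalities is stated only for φ_s>1 instead of φ_s≠1, because for φ_s<1 the convention B_0(ϑ,θ)=0 for θ∈(0,1] makes every bias term 0 and strict inequality fails. *)

theory Defs
  imports "HOL-Probability.Probability"
begin

text \<open>
  The penalty \<open>lam \<ge> 0\<close> is passed where the notation \<open>v(-\<lambda>; \<theta>)\<close> carries the spectral
  argument \<open>-\<lambda>\<close>. Aspect ratios are extended reals because \<open>\<theta> = \<infinity>\<close> is allowed; \<open>\<eta>\<close>
  stands for vartheta, and \<open>\<eta> \<le> \<theta>\<close> makes it infinite only together with \<open>\<theta>\<close>.
  The parameters \<open>rho2\<close> and \<open>sigma2\<close> stand for \<open>\<rho>\<^sup>2\<close> and \<open>\<sigma>\<^sup>2\<close>.
\<close>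

text \<open>
  Meant for \<open>lam > 0\<close> and \<open>\<theta> > 0\<close> only. Since \<open>1 / 0 = 0\<close> in HOL and the right-hand side
  is positive, \<open>v = 0\<close> does not solve the equation.
\<close>
definition fp_sol :: "real measure \<Rightarrow> real \<Rightarrow> real \<Rightarrow> real" where
  "fp_sol H lam \<theta> =
    (THE v. 0 \<le> v \<and> 1 / v = lam + \<theta> * (\<integral>r. r / (1 + v * r) \<partial>H))"

definition v_fp :: "real measure \<Rightarrow> real \<Rightarrow> ereal \<Rightarrow> ereal" where
  "v_fp H lam \<theta> =
    (if \<theta> = \<infinity> then 0
     else if lam > 0 then ereal (fp_sol H lam (real_of_ereal \<theta>))
     else if \<theta> > 1 then ereal (Lim (at_right 0) (\<lambda>l. fp_sol H l (real_of_ereal \<theta>)))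
     else \<infinity>)"

text \<open>
  The values of \<open>v_tilde\<close> and \<open>c_tilde\<close> are meaningless when \<open>v_fp\<close> is infinite, i.e. for
  \<open>lam = 0\<close> and \<open>\<theta> \<le> 1\<close>; \<open>B_fun\<close> and \<open>V_fun\<close> treat that case separately.
\<close>
definition v_tilde :: "real measure \<Rightarrow> real \<Rightarrow> ereal \<Rightarrow> ereal \<Rightarrow> real" where
  "v_tilde H lam \<eta> \<theta> =
    (if \<theta> = \<infinity> then 0
     else let v = real_of_ereal (v_fp H lam \<theta>);
              I = (\<integral>r. r\<^sup>2 / (1 + v * r)\<^sup>2 \<partial>H)
          in (real_of_ereal \<eta> * I) / (1 / v\<^sup>2 - real_of_ereal \<eta> * I))"

definition c_tilde :: "real measure \<Rightarrow> real measure \<Rightarrow> real \<Rightarrow> ereal \<Rightarrow> real" where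
  "c_tilde H G lam \<theta> =
    (let v = real_of_ereal (v_fp H lam \<theta>) in (\<integral>r. r / (1 + v * r)\<^sup>2 \<partial>G))"

definition B_fun ::
  "real measure \<Rightarrow> real measure \<Rightarrow> real \<Rightarrow> real \<Rightarrow> ereal \<Rightarrow> ereal \<Rightarrow> real" where
  "B_fun H G rho2 lam \<eta> \<theta> =
    (if lam = 0 \<and> \<theta> \<le> 1 then 0
     else rho2 * (1 + v_tilde H lam \<eta> \<theta>) * c_tilde H G lam \<theta>)"

text \<open>The value \<open>\<infinity>\<close> at \<open>lam = 0\<close>, \<open>\<theta> = 1\<close> is taken for every \<open>sigma2\<close>, including 0.\<close>
definition V_fun :: "real measure \<Rightarrow> real \<Rightarrow> real \<Rightarrow> ereal \<Rightarrow> ereal \<Rightarrow> ereal" where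
  "V_fun H sigma2 lam \<eta> \<theta> =
    (if lam = 0 \<and> \<theta> = 1 then \<infinity>
     else if lam = 0 \<and> \<theta> < 1
       then ereal (sigma2 * real_of_ereal \<eta> / (1 - real_of_ereal \<eta>))
     else ereal (sigma2 * v_tilde H lam \<eta> \<theta>))"

definition B_sub ::
  "real measure \<Rightarrow> real measure \<Rightarrow> real \<Rightarrow> real \<Rightarrow> enat \<Rightarrow> ereal \<Rightarrow> ereal \<Rightarrow> real" where
  "B_sub H G rho2 lam M \<phi> \<phi>s =
    (case M of
       enat m \<Rightarrow> 1 / real m * B_fun H G rho2 lam \<phi>s \<phi>s
                + (1 - 1 / real m) * B_fun H G rho2 lam \<phi> \<phi>s
     | \<infinity> \<Rightarrow> B_fun H G rho2 lam \<phi> \<phi>s)"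

text \<open>At \<open>M = 1\<close> the second summand vanishes even if \<open>V_fun\<close> is infinite, as \<open>0 * \<infinity> = 0\<close>.\<close>
definition V_sub ::
  "real measure \<Rightarrow> real \<Rightarrow> real \<Rightarrow> enat \<Rightarrow> ereal \<Rightarrow> ereal \<Rightarrow> ereal" where
  "V_sub H sigma2 lam M \<phi> \<phi>s =
    (case M of
       enat m \<Rightarrow> ereal (1 / real m) * V_fun H sigma2 lam \<phi>s \<phi>s
                + ereal (1 - 1 / real m) * V_fun H sigma2 lam \<phi> \<phi>s
     | \<infinity> \<Rightarrow> V_fun H sigma2 lam \<phi> \<phi>s)"

definition R_sub ::
  "real measure \<Rightarrow> real measure \<Rightarrow> real \<Rightarrow> real \<Rightarrow> real \<Rightarrow> enat \<Rightarrow> ereal \<Rightarrow> ereal \<Rightarrow> ereal" where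
  "R_sub H G rho2 sigma2 lam M \<phi> \<phi>s =
    ereal sigma2 + ereal (B_sub H G rho2 lam M \<phi> \<phi>s) + V_sub H sigma2 lam M \<phi> \<phi>s"

text \<open>
  In the ridgeless case the bias vanishes identically for \<open>\<phi>s \<le> 1\<close>, so strict monotonicity
  of the bias at \<open>lam = 0\<close> is possible only for \<open>\<phi>s > 1\<close>; excluding just \<open>\<phi>s = 1\<close> does not suffice.
\<close>
lemma B_sub_ridgeless_eq_0:
  assumes "\<phi>s \<le> 1"
  shows "B_sub H G rho2 0 M \<phi> \<phi>s = 0"
  using assms by (simp add: B_sub_def B_fun_def split: enat.split)

end

theory Submission
  imports Defs
begin

text \<open>
  Bagging \<open>M\<close> predictors replaces a risk component \<open>x\<close> (one predictor, equal aspect ratios) by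
  the average \<open>x / M + (1 - 1 / M) y\<close>, where \<open>y\<close> is the same component at \<open>\<vartheta> = \<phi>\<close> instead of
  \<open>\<vartheta> = \<phi>\<^sub>s\<close>. Such an average falls towards \<open>y\<close> as \<open>M\<close> grows precisely when \<open>y \<le> x\<close>, so everything
  reduces to monotonicity of bias and variance in their first aspect ratio \<open>\<vartheta>\<close>.

  Both depend on \<open>\<vartheta>\<close> only through \<open>\<vartheta> I / (v\<^sup>-\<^sup>2 - \<vartheta> I)\<close> with \<open>I = \<integral> r\<^sup>2 / (1 + v r)\<^sup>2 dH(r) > 0\<close>, and
  \<open>v\<close> does not involve \<open>\<vartheta>\<close>. This is strictly increasing as long as the denominator is positive at
  the largest admissible value \<open>\<vartheta> = \<theta>\<close>. Positivity comes from the fixed-point equation itself: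
  multiplied by \<open>v\<close> it reads \<open>\<lambda> v + \<theta> D(v) = 1\<close> with \<open>D(v) = \<integral> v r / (1 + v r) dH(r)\<close>, and
  \<open>(v r / (1 + v r))\<^sup>2 < v r / (1 + v r)\<close> because that fraction lies strictly between 0 and 1,
  whence \<open>\<theta> v\<^sup>2 I < \<theta> D(v) \<le> 1\<close> (\<open>fixed_point_denominator_pos\<close>).

  What remains is that \<open>v\<close> really is a positive solution. The balance \<open>\<lambda> v + \<theta> D(v)\<close> is continuous,
  strictly increasing and 0 at 0, and it reaches 1 if \<open>\<lambda> > 0\<close> or if \<open>\<theta> > 1\<close>
  (\<open>ex1_fixed_point\<close>). In the ridgeless case the value is prescribed as a limit for \<open>\<lambda> \<rightarrow> 0\<close>, and
  comparing balances shows that this limit is the solution of \<open>\<theta> D(v) = 1\<close>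
  (\<open>fp_sol_tendsto_ridgeless\<close>), so one argument serves both cases. The remaining ridgeless cases
  \<open>\<theta> \<le> 1\<close> and the null predictor \<open>\<theta> = \<infinity>\<close> are explicit.
\<close>

section \<open>Integrals against a spectral distribution\<close>

locale spectral_distribution = real_distribution H for H :: "real measure" +
  fixes rmin rmax :: real
  assumes rmin_pos: "0 < rmin"
    and AE_spectrum: "AE r in H. r \<in> {rmin..rmax}"
begin

lemma integrable_if_continuous_on_spectrum:
  fixes f :: "real \<Rightarrow> real"
  assumes "f \<in> borel_measurable borel" and "continuous_on {rmin..rmax} f"
  shows "integrable H f"
proof -
  have "compact (f ` {rmin..rmax})"
    using assms(2) by (intro compact_continuous_image) auto
  then obtain b where "\<And>r. r \<in> {rmin..rmax} \<Longrightarrow> norm (f r) \<le> b"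
    using compact_imp_bounded bounded_iff by (metis imageI)
  then have "AE r in H. norm (f r) \<le> b"
    using AE_spectrum by auto
  then show ?thesis
    using assms(1) by (intro integrable_const_bound) auto
qed

lemma integral_spectrum_ge:
  fixes f :: "real \<Rightarrow> real"
  assumes "integrable H f" and "\<And>r. r \<in> {rmin..rmax} \<Longrightarrow> c \<le> f r"
  shows "c \<le> (\<integral>r. f r \<partial>H)"
  using assms AE_spectrum by (intro integral_ge_const) auto

text \<open>
  On a compact spectrum the infimum of a positive continuous function is attained, hence positive.
\<close>
lemma integral_spectrum_pos:
  fixes f :: "real \<Rightarrow> real"
  assumes "f \<in> borel_measurable borel" and cont: "continuous_on {rmin..rmax} f"
    and pos: "\<And>r. r \<in> {rmin..rmax} \<Longrightarrow> 0 < f r"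
  shows "0 < (\<integral>r. f r \<partial>H)"
proof -
  have "rmin \<le> rmax"
  proof (rule ccontr)
    assume "\<not> rmin \<le> rmax"
    then have "AE r in H. False" using AE_spectrum by auto
    then show False by simp
  qed
  then obtain r0 where r0: "r0 \<in> {rmin..rmax}" "\<And>r. r \<in> {rmin..rmax} \<Longrightarrow> f r0 \<le> f r"
    using continuous_attains_inf[OF _ _ cont] by auto
  have "0 < f r0" using pos r0(1) .
  also have "f r0 \<le> (\<integral>r. f r \<partial>H)"
    using assms r0(2) by (intro integral_spectrum_ge integrable_if_continuous_on_spectrum)
  finally show ?thesis .
qed

lemma denominator_pos: "0 < 1 + v * r" if "0 \<le> v" "r \<in> {rmin..rmax}"
  using that rmin_pos by (simp add: add_pos_nonneg)

section \<open>The fixed-point equation\<close>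

text \<open>
  The limit of the normalised effective degrees of freedom
  \<open>tr (\<Sigma> (\<Sigma> + v\<^sup>-\<^sup>1 I)\<^sup>-\<^sup>1) / p\<close> of ridge regression with penalty \<open>v\<^sup>-\<^sup>1\<close>.
\<close>
definition deg_freedom :: "real \<Rightarrow> real" where
  "deg_freedom v = (\<integral>r. v * r / (1 + v * r) \<partial>H)"

lemma deg_freedom_0: "deg_freedom 0 = 0"
  by (simp add: deg_freedom_def)

lemma integrable_deg_freedom:
  assumes "0 \<le> v" shows "integrable H (\<lambda>r. v * r / (1 + v * r))"
  using denominator_pos[OF assms]
  by (intro integrable_if_continuous_on_spectrum) (auto intro!: continuous_intros, fastforce)

lemma deg_freedom_diff:
  assumes "0 \<le> v" "0 \<le> w"
  shows "deg_freedom w - deg_freedom v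
    = (w - v) * (\<integral>r. r / ((1 + v * r) * (1 + w * r)) \<partial>H)"
proof -
  have "deg_freedom w - deg_freedom v
      = (\<integral>r. w * r / (1 + w * r) - v * r / (1 + v * r) \<partial>H)"
    using assms by (simp add: deg_freedom_def integrable_deg_freedom)
  also have "\<dots> = (\<integral>r. (w - v) * (r / ((1 + v * r) * (1 + w * r))) \<partial>H)"
  proof (rule integral_cong_AE)
    show "AE r in H. w * r / (1 + w * r) - v * r / (1 + v * r)
        = (w - v) * (r / ((1 + v * r) * (1 + w * r)))"
      using AE_spectrum
    proof eventually_elim
      case (elim r)
      have "1 + v * r \<noteq> 0" "1 + w * r \<noteq> 0"
        using denominator_pos[OF _ elim] assms by fastforce+
      then show ?case by (simp add: divide_simps) (simp add: algebra_simps)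
    qed
  qed auto
  finally show ?thesis by (simp only: integral_mult_right_zero)
qed

lemma deg_freedom_strict_mono:
  assumes "0 \<le> v" "v < w"
  shows "deg_freedom v < deg_freedom w"
proof -
  have d: "0 < 1 + v * r" "0 < 1 + w * r" if "r \<in> {rmin..rmax}" for r
    using denominator_pos that assms by auto
  have "0 < (\<integral>r. r / ((1 + v * r) * (1 + w * r)) \<partial>H)"
  proof (rule integral_spectrum_pos)
    show "continuous_on {rmin..rmax} (\<lambda>r. r / ((1 + v * r) * (1 + w * r)))"
      using d by (intro continuous_intros) fastforce
  qed (use d rmin_pos in auto)
  then show ?thesis
    using deg_freedom_diff[of v w] assms by (smt (verit) mult_pos_pos)
qed

text \<open>The kernel of the difference quotient is at most \<open>r \<le> rmax\<close>, so a Lipschitz bound holds.\<close>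
lemma continuous_on_deg_freedom: "continuous_on {0..} deg_freedom"
proof -
  have "rmax-lipschitz_on {0..} deg_freedom"
  proof (rule lipschitz_on_leI)
    fix v w :: real
    assume vw: "v \<in> {0..}" "w \<in> {0..}" "v \<le> w"
    have d: "1 \<le> (1 + v * r) * (1 + w * r)" if "r \<in> {rmin..rmax}" for r
    proof -
      have "1 \<le> 1 + v * r" "1 \<le> 1 + w * r" using vw that rmin_pos by auto
      from mult_mono[OF this] this show ?thesis by linarith
    qed
    have le: "r / ((1 + v * r) * (1 + w * r)) \<le> rmax" if "r \<in> {rmin..rmax}" for r
      using frac_le[of r r 1, OF _ _ _ d[OF that]] that rmin_pos by simp
    have "integrable H (\<lambda>r. r / ((1 + v * r) * (1 + w * r)))"
      by (intro integrable_if_continuous_on_spectrum)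
        (use d in \<open>force intro!: continuous_intros\<close>)+
    then have "(\<integral>r. r / ((1 + v * r) * (1 + w * r)) \<partial>H) \<le> rmax"
      using AE_spectrum le by (intro integral_le_const) auto
    then have "deg_freedom w - deg_freedom v \<le> rmax * (w - v)"
      using vw deg_freedom_diff[of v w] mult_left_mono[of _ rmax "w - v"]
      by (simp add: mult.commute[of rmax])
    moreover have "deg_freedom v \<le> deg_freedom w"
      using vw deg_freedom_strict_mono[of v w] by fastforce
    ultimately show "dist (deg_freedom v) (deg_freedom w) \<le> rmax * dist v w"
      using vw by (simp add: dist_real_def)
  next
    show "0 \<le> rmax"
    proof (rule ccontr)
      assume "\<not> 0 \<le> rmax"
      then have "AE r in H. False" using AE_spectrum rmin_pos by auto
      then show False by simp
    qed
  qed
  then show ?thesis by (rule lipschitz_on_continuous_on)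
qed

lemma balance_strict_mono:
  assumes "0 < \<theta>" "0 \<le> lam" "0 \<le> v" "v < w"
  shows "lam * v + \<theta> * deg_freedom v < lam * w + \<theta> * deg_freedom w"
  using assms by (intro add_le_less_mono mult_left_mono mult_strict_left_mono
      deg_freedom_strict_mono) auto

text \<open>
  If \<open>\<theta> > 1\<close>, the lower edge of the spectrum alone forces the balance up to 1: since
  \<open>v r / (1 + v r)\<close> increases in \<open>r\<close>, it is at least \<open>1 / \<theta>\<close> once \<open>v rmin (\<theta> - 1) = 1\<close>.
\<close>
lemma ex1_fixed_point:
  assumes "0 < \<theta>" "0 \<le> lam" "0 < lam \<or> 1 < \<theta>"
  shows "\<exists>!v. 0 \<le> v \<and> lam * v + \<theta> * deg_freedom v = 1"
proof -
  have nonneg: "0 \<le> deg_freedom v" if "0 \<le> v" for v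
    using deg_freedom_strict_mono[of 0 v] deg_freedom_0 that by (cases "v = 0") auto
  have "\<exists>u\<ge>0. 1 \<le> lam * u + \<theta> * deg_freedom u"
  proof (cases "0 < lam")
    case True
    then show ?thesis
      using nonneg[of "1 / lam"] assms by (intro exI[of _ "1 / lam"]) auto
  next
    case False
    then have \<theta>: "1 < \<theta>" using assms by simp
    define u where "u = 1 / (rmin * (\<theta> - 1))"
    have u: "0 < u" and urmin: "u * rmin = 1 / (\<theta> - 1)"
      using \<theta> rmin_pos by (auto simp: u_def)
    have "1 / \<theta> \<le> deg_freedom u"
      unfolding deg_freedom_def
    proof (rule integral_spectrum_ge)
      fix r assume r: "r \<in> {rmin..rmax}"
      have "1 / (\<theta> - 1) \<le> u * r"
        unfolding urmin[symmetric] using u r by simp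
      then show "1 / \<theta> \<le> u * r / (1 + u * r)"
        using \<theta> denominator_pos[OF _ r, of u] u by (simp add: field_simps)
    qed (use u integrable_deg_freedom in auto)
    then have "1 \<le> \<theta> * deg_freedom u" using \<theta> by (simp add: field_simps)
    moreover have "0 \<le> lam * u" using u assms by simp
    ultimately show ?thesis using u by (intro exI[of _ u]) auto
  qed
  then obtain u where u: "0 \<le> u" "1 \<le> lam * u + \<theta> * deg_freedom u" by blast
  have "continuous_on {0..u} (\<lambda>v. lam * v + \<theta> * deg_freedom v)"
    by (intro continuous_intros continuous_on_subset[OF continuous_on_deg_freedom]) auto
  with u have "\<exists>v\<ge>0. v \<le> u \<and> lam * v + \<theta> * deg_freedom v = 1"
    by (intro IVT') (auto simp: deg_freedom_0)
  then show ?thesis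
    using balance_strict_mono[OF assms(1,2)] by (metis less_irrefl linorder_neqE_linordered_idom)
qed

lemma fixed_point_iff:
  assumes "0 < lam" "0 < \<theta>"
  shows "0 \<le> v \<and> 1 / v = lam + \<theta> * (\<integral>r. r / (1 + v * r) \<partial>H)
    \<longleftrightarrow> 0 \<le> v \<and> lam * v + \<theta> * deg_freedom v = 1"
proof (cases "0 < v")
  case True
  have "deg_freedom v = v * (\<integral>r. r / (1 + v * r) \<partial>H)"
    unfolding deg_freedom_def by (simp flip: integral_mult_right_zero)
  then show ?thesis using True by (auto simp: field_simps)
next
  case False
  \<comment> \<open>At \<open>v = 0\<close> the left-hand side \<open>1 / 0 = 0\<close> is below the positive right-hand side.\<close>
  have "0 \<le> (\<integral>r. r \<partial>H)"
    using AE_spectrum rmin_pos by (intro integral_nonneg_AE) auto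
  then have "0 < lam + \<theta> * (\<integral>r. r \<partial>H)"
    using assms by (simp add: add_pos_nonneg)
  then show ?thesis using False by (cases "v = 0") (auto simp: deg_freedom_0)
qed

lemma fp_sol_fixed_point:
  assumes "0 < lam" "0 < \<theta>"
  shows "0 < fp_sol H lam \<theta>"
    and "lam * fp_sol H lam \<theta> + \<theta> * deg_freedom (fp_sol H lam \<theta>) = 1"
proof -
  have "fp_sol H lam \<theta> = (THE v. 0 \<le> v \<and> lam * v + \<theta> * deg_freedom v = 1)"
    unfolding fp_sol_def using fixed_point_iff[OF assms] by simp
  then have sol: "0 \<le> fp_sol H lam \<theta>"
    "lam * fp_sol H lam \<theta> + \<theta> * deg_freedom (fp_sol H lam \<theta>) = 1"
    using theI'[OF ex1_fixed_point[of \<theta> lam]] assms by auto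
  show "lam * fp_sol H lam \<theta> + \<theta> * deg_freedom (fp_sol H lam \<theta>) = 1" by (fact sol(2))
  then show "0 < fp_sol H lam \<theta>"
    using sol(1) deg_freedom_0 by (cases "fp_sol H lam \<theta> = 0") auto
qed

text \<open>
  The ridge solution stays below \<open>v\<close>, where the penalty term pushes the balance above 1. Any
  \<open>w < v\<close> has ridgeless balance less than 1, and a small enough penalty keeps it there, so
  \<open>w\<close> is eventually below the ridge solution.
\<close>
lemma fp_sol_tendsto_ridgeless:
  assumes "0 < \<theta>" "0 < v" "\<theta> * deg_freedom v = 1"
  shows "((\<lambda>l. fp_sol H l \<theta>) \<longlongrightarrow> v) (at_right 0)"
proof (rule order_tendstoI)
  have above: "w < fp_sol H l \<theta>" if "0 < l" "0 \<le> w" "l * w + \<theta> * deg_freedom w < 1" for l w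
  proof (rule ccontr)
    assume "\<not> w < fp_sol H l \<theta>"
    then have "fp_sol H l \<theta> = w \<or> fp_sol H l \<theta> < w" by auto
    then show False
      using fp_sol_fixed_point[of l \<theta>] balance_strict_mono[of \<theta> l "fp_sol H l \<theta>" w] that assms
      by auto
  qed
  fix w assume w: "w < v"
  show "eventually (\<lambda>l. w < fp_sol H l \<theta>) (at_right 0)"
  proof (cases "0 \<le> w")
    case True
    then have lt: "\<theta> * deg_freedom w < 1"
      using deg_freedom_strict_mono[OF True w] assms by (metis mult_strict_left_mono)
    have "((\<lambda>l. l * w + \<theta> * deg_freedom w) \<longlongrightarrow> 0 * w + \<theta> * deg_freedom w) (at_right 0)"
      by (intro tendsto_intros)
    then have "eventually (\<lambda>l. l * w + \<theta> * deg_freedom w < 1) (at_right 0)"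
      using lt by (auto dest: order_tendstoD(2))
    with eventually_at_right_less[of 0] show ?thesis
      by eventually_elim (use above True in auto)
  next
    case False
    show ?thesis
      using eventually_at_right_less[of 0]
      by eventually_elim (use fp_sol_fixed_point(1) assms(1) False in force)
  qed
next
  fix w assume w: "v < w"
  show "eventually (\<lambda>l. fp_sol H l \<theta> < w) (at_right 0)"
    using eventually_at_right_less[of 0]
  proof eventually_elim
    case (elim l)
    have "0 < l * v" using assms elim by simp
    moreover have "l * v + \<theta> * deg_freedom v \<le> 1" if "v \<le> fp_sol H l \<theta>"
      using fp_sol_fixed_point(2)[OF elim assms(1)] that assms elim
        balance_strict_mono[of \<theta> l v "fp_sol H l \<theta>"]
      by (cases "fp_sol H l \<theta> = v") auto
    ultimately have "fp_sol H l \<theta> < v"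
      using assms(3) by force
    then show ?case using w by simp
  qed
qed

lemma v_fp_fixed_point:
  assumes "0 < \<theta>" "0 \<le> lam" "0 < lam \<or> 1 < \<theta>"
  obtains v where "0 < v" "v_fp H lam (ereal \<theta>) = ereal v" "lam * v + \<theta> * deg_freedom v = 1"
proof (cases "0 < lam")
  case True
  then show thesis
    using that[of "fp_sol H lam \<theta>"] fp_sol_fixed_point[OF True assms(1)] by (simp add: v_fp_def)
next
  case False
  then have lam: "lam = 0" and \<theta>: "1 < \<theta>" using assms by auto
  obtain v where v: "0 \<le> v" "\<theta> * deg_freedom v = 1"
    using ex1_fixed_point[of \<theta> 0] \<theta> by auto
  then have pos: "0 < v" using deg_freedom_0 by (cases "v = 0") auto
  have "Lim (at_right 0) (\<lambda>l. fp_sol H l \<theta>) = v"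
    using fp_sol_tendsto_ridgeless[OF assms(1) pos v(2)] by (intro tendsto_Lim) auto
  then show thesis
    using that[of v] pos v lam \<theta> by (simp add: v_fp_def one_ereal_def)
qed

end

section \<open>Monotonicity in the first aspect ratio\<close>

text \<open>
  The shape in which the first aspect ratio enters both \<open>v_tilde\<close> (with \<open>a = v\<^sup>-\<^sup>2\<close>) and the
  variance of ordinary least squares (with \<open>a = 1\<close>).
\<close>
lemma odds_strict_mono:
  fixes a x y :: real
  assumes "0 < a" "x < y" "y < a"
  shows "x / (a - x) < y / (a - y)"
proof -
  have "x * (a - y) < y * (a - x)"
    using assms by (simp add: algebra_simps)
  then show ?thesis
    using assms by (simp add: pos_divide_less_eq pos_less_divide_eq)
qed

context spectral_distribution
begin

lemma second_moment_pos:
  assumes "0 \<le> v"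
  shows "0 < (\<integral>r. r\<^sup>2 / (1 + v * r)\<^sup>2 \<partial>H)"
proof (rule integral_spectrum_pos)
  show "continuous_on {rmin..rmax} (\<lambda>r. r\<^sup>2 / (1 + v * r)\<^sup>2)"
    using denominator_pos[OF assms] by (intro continuous_intros) force
  show "0 < r\<^sup>2 / (1 + v * r)\<^sup>2" if "r \<in> {rmin..rmax}" for r
    using denominator_pos[OF assms that] that rmin_pos by simp
qed auto

lemma first_moment_pos:
  assumes "0 \<le> v"
  shows "0 < (\<integral>r. r / (1 + v * r)\<^sup>2 \<partial>H)"
proof (rule integral_spectrum_pos)
  show "continuous_on {rmin..rmax} (\<lambda>r. r / (1 + v * r)\<^sup>2)"
    using denominator_pos[OF assms] by (intro continuous_intros) force
  show "0 < r / (1 + v * r)\<^sup>2" if "r \<in> {rmin..rmax}" for r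
    using denominator_pos[OF assms that] that rmin_pos by simp
qed auto

text \<open>
  With \<open>x = v r / (1 + v r)\<close>, the gap between \<open>D(v)\<close> and \<open>v\<^sup>2 I\<close> is \<open>\<integral> x (1 - x) dH\<close>, that is,
  \<open>v\<close> times a first moment of the kind that also gives the bias.
\<close>
lemma fixed_point_denominator_pos:
  assumes "0 < \<theta>" "0 \<le> lam" "0 < v" "lam * v + \<theta> * deg_freedom v = 1"
  shows "\<theta> * (\<integral>r. r\<^sup>2 / (1 + v * r)\<^sup>2 \<partial>H) < 1 / v\<^sup>2"
proof -
  have d: "0 < 1 + v * r" if "r \<in> {rmin..rmax}" for r
    using denominator_pos that assms(3) by auto
  have int: "integrable H (\<lambda>r. r\<^sup>2 / (1 + v * r)\<^sup>2)" "integrable H (\<lambda>r. r / (1 + v * r)\<^sup>2)"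
    by (intro integrable_if_continuous_on_spectrum; use d in \<open>force intro!: continuous_intros\<close>)+
  have "deg_freedom v = (\<integral>r. v\<^sup>2 * (r\<^sup>2 / (1 + v * r)\<^sup>2) + v * (r / (1 + v * r)\<^sup>2) \<partial>H)"
    unfolding deg_freedom_def
  proof (rule integral_cong_AE)
    show "AE r in H. v * r / (1 + v * r)
        = v\<^sup>2 * (r\<^sup>2 / (1 + v * r)\<^sup>2) + v * (r / (1 + v * r)\<^sup>2)"
      using AE_spectrum
    proof eventually_elim
      case (elim r)
      have "v * r / (1 + v * r) = (v * r) * (1 + v * r) / (1 + v * r)\<^sup>2"
        using d[OF elim] by (simp add: power2_eq_square)
      then show ?case
        by (simp add: power2_eq_square algebra_simps flip: add_divide_distrib)
    qed
  qed auto
  also have "\<dots> = v\<^sup>2 * (\<integral>r. r\<^sup>2 / (1 + v * r)\<^sup>2 \<partial>H) + v * (\<integral>r. r / (1 + v * r)\<^sup>2 \<partial>H)"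
    using int by (simp del: times_divide_eq_right)
  finally have "v\<^sup>2 * (\<integral>r. r\<^sup>2 / (1 + v * r)\<^sup>2 \<partial>H) < deg_freedom v"
    using first_moment_pos[of v] assms(3) by simp
  then have "\<theta> * (v\<^sup>2 * (\<integral>r. r\<^sup>2 / (1 + v * r)\<^sup>2 \<partial>H)) < \<theta> * deg_freedom v"
    using assms(1) by (rule mult_strict_left_mono)
  also have "\<dots> \<le> 1"
    using assms by (smt (verit) mult_nonneg_nonneg)
  finally show ?thesis using assms(3) by (simp add: field_simps)
qed

lemma v_tilde_strict_mono:
  assumes "\<eta> < \<eta>'" "\<eta>' \<le> \<theta>" "0 < \<theta>" "0 \<le> lam" "0 < lam \<or> 1 < \<theta>"
  shows "v_tilde H lam (ereal \<eta>) (ereal \<theta>) < v_tilde H lam (ereal \<eta>') (ereal \<theta>)"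
proof -
  obtain v where v: "0 < v" "v_fp H lam (ereal \<theta>) = ereal v" "lam * v + \<theta> * deg_freedom v = 1"
    using v_fp_fixed_point assms by metis
  define I where "I = (\<integral>r. r\<^sup>2 / (1 + v * r)\<^sup>2 \<partial>H)"
  have I: "0 < I" using second_moment_pos[of v] v by (simp add: I_def)
  have "\<theta> * I < 1 / v\<^sup>2"
    using fixed_point_denominator_pos v assms by (simp add: I_def)
  moreover have lt: "\<eta> * I < \<eta>' * I" and "\<eta>' * I \<le> \<theta> * I"
    using assms I by (auto intro: mult_right_mono)
  ultimately have pos: "0 < 1 / v\<^sup>2 - \<eta> * I" "0 < 1 / v\<^sup>2 - \<eta>' * I" by linarith+
  have "\<eta> * I / (1 / v\<^sup>2 - \<eta> * I) < \<eta>' * I / (1 / v\<^sup>2 - \<eta>' * I)"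
    using pos lt v by (intro odds_strict_mono) auto
  then show ?thesis using v by (simp add: v_tilde_def I_def Let_def)
qed

text \<open>Here the measure of the locale is the signal-weighted spectrum; \<open>H'\<close> enters through \<open>v\<close> only.\<close>
lemma c_tilde_pos:
  assumes "0 \<le> real_of_ereal (v_fp H' lam \<theta>)"
  shows "0 < c_tilde H' H lam \<theta>"
  using first_moment_pos[OF assms] by (simp add: c_tilde_def Let_def)

end

section \<open>Averaging over bags\<close>

lemma convex_average_decreasing:
  fixes x y :: real
  assumes "1 \<le> M" "y \<le> x"
  shows "y \<le> 1 / real (M + 1) * x + (1 - 1 / real (M + 1)) * y"
    and "1 / real (M + 1) * x + (1 - 1 / real (M + 1)) * y
      \<le> 1 / real M * x + (1 - 1 / real M) * y"
    and "y < x \<Longrightarrow> y < 1 / real (M + 1) * x + (1 - 1 / real (M + 1)) * y"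
    and "y < x \<Longrightarrow> 1 / real (M + 1) * x + (1 - 1 / real (M + 1)) * y
      < 1 / real M * x + (1 - 1 / real M) * y"
proof -
  have avg: "1 / real m * x + (1 - 1 / real m) * y = y + (x - y) / real m" for m
    by (simp add: algebra_simps diff_divide_distrib)
  show "y \<le> 1 / real (M + 1) * x + (1 - 1 / real (M + 1)) * y"
    unfolding avg using assms by simp
  show "1 / real (M + 1) * x + (1 - 1 / real (M + 1)) * y
      \<le> 1 / real M * x + (1 - 1 / real M) * y"
    unfolding avg using assms by (simp add: divide_left_mono)
  show "y < 1 / real (M + 1) * x + (1 - 1 / real (M + 1)) * y" if "y < x"
    unfolding avg using assms that by simp
  show "1 / real (M + 1) * x + (1 - 1 / real (M + 1)) * y
      < 1 / real M * x + (1 - 1 / real M) * y" if "y < x"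
    unfolding avg using assms that by (simp add: divide_strict_left_mono)
qed

lemma B_sub_decreasing:
  assumes "1 \<le> M" "B_fun H G rho2 lam \<phi> \<phi>s \<le> B_fun H G rho2 lam \<phi>s \<phi>s"
  shows "B_sub H G rho2 lam \<infinity> \<phi> \<phi>s \<le> B_sub H G rho2 lam (enat (M + 1)) \<phi> \<phi>s"
    and "B_sub H G rho2 lam (enat (M + 1)) \<phi> \<phi>s \<le> B_sub H G rho2 lam (enat M) \<phi> \<phi>s"
    and "B_fun H G rho2 lam \<phi> \<phi>s < B_fun H G rho2 lam \<phi>s \<phi>s \<Longrightarrow>
      B_sub H G rho2 lam \<infinity> \<phi> \<phi>s < B_sub H G rho2 lam (enat (M + 1)) \<phi> \<phi>s"
    and "B_fun H G rho2 lam \<phi> \<phi>s < B_fun H G rho2 lam \<phi>s \<phi>s \<Longrightarrow>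
      B_sub H G rho2 lam (enat (M + 1)) \<phi> \<phi>s < B_sub H G rho2 lam (enat M) \<phi> \<phi>s"
  unfolding B_sub_def enat.case using convex_average_decreasing[OF assms] by simp_all

lemma V_sub_decreasing:
  assumes "1 \<le> M" "V_fun H sigma2 lam \<phi> \<phi>s = ereal y" "V_fun H sigma2 lam \<phi>s \<phi>s = ereal x" "y \<le> x"
  shows "V_sub H sigma2 lam \<infinity> \<phi> \<phi>s \<le> V_sub H sigma2 lam (enat (M + 1)) \<phi> \<phi>s"
    and "V_sub H sigma2 lam (enat (M + 1)) \<phi> \<phi>s \<le> V_sub H sigma2 lam (enat M) \<phi> \<phi>s"
    and "y < x \<Longrightarrow> V_sub H sigma2 lam \<infinity> \<phi> \<phi>s < V_sub H sigma2 lam (enat (M + 1)) \<phi> \<phi>s"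
    and "y < x \<Longrightarrow> V_sub H sigma2 lam (enat (M + 1)) \<phi> \<phi>s < V_sub H sigma2 lam (enat M) \<phi> \<phi>s"
  unfolding V_sub_def enat.case assms(2,3)
  using convex_average_decreasing[OF assms(1,4)] by simp_all

section \<open>Monotonicity of the risk in the number of bags\<close>

theorem proposition3p5:
  fixes H G :: "real measure"
    and rmin rmax rho2 sigma2 lam \<phi> :: real
    and \<phi>s :: ereal
    and M :: nat
  assumes "0 < rmin" and "rmin \<le> rmax"
    and "real_distribution H" and "AE r in H. r \<in> {rmin..rmax}"
    and "real_distribution G" and "AE r in G. r \<in> {rmin..rmax}"
    and "0 \<le> rho2" and "0 \<le> sigma2"
    and "0 \<le> lam" and "0 < \<phi>" and "ereal \<phi> \<le> \<phi>s"
    and "1 \<le> M"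
  shows "B_sub H G rho2 lam \<infinity> \<phi> \<phi>s \<le> B_sub H G rho2 lam (enat (M + 1)) \<phi> \<phi>s
      \<and> B_sub H G rho2 lam (enat (M + 1)) \<phi> \<phi>s \<le> B_sub H G rho2 lam (enat M) \<phi> \<phi>s
      \<and> V_sub H sigma2 lam \<infinity> \<phi> \<phi>s \<le> V_sub H sigma2 lam (enat (M + 1)) \<phi> \<phi>s
      \<and> V_sub H sigma2 lam (enat (M + 1)) \<phi> \<phi>s \<le> V_sub H sigma2 lam (enat M) \<phi> \<phi>s
      \<and> (0 < rho2 \<and> ereal \<phi> < \<phi>s \<and> \<phi>s < \<infinity> \<and> (lam = 0 \<longrightarrow> 1 < \<phi>s) \<longrightarrow>
           B_sub H G rho2 lam \<infinity> \<phi> \<phi>s < B_sub H G rho2 lam (enat (M + 1)) \<phi> \<phi>s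
         \<and> B_sub H G rho2 lam (enat (M + 1)) \<phi> \<phi>s < B_sub H G rho2 lam (enat M) \<phi> \<phi>s)
      \<and> (0 < sigma2 \<and> ereal \<phi> < \<phi>s \<and> \<phi>s < \<infinity> \<and> (lam = 0 \<longrightarrow> \<phi>s \<noteq> 1) \<longrightarrow>
           V_sub H sigma2 lam \<infinity> \<phi> \<phi>s < V_sub H sigma2 lam (enat (M + 1)) \<phi> \<phi>s
         \<and> V_sub H sigma2 lam (enat (M + 1)) \<phi> \<phi>s < V_sub H sigma2 lam (enat M) \<phi> \<phi>s)
      \<and> R_sub H G rho2 sigma2 lam \<infinity> \<phi> \<phi>s \<le> R_sub H G rho2 sigma2 lam (enat (M + 1)) \<phi> \<phi>s
      \<and> R_sub H G rho2 sigma2 lam (enat (M + 1)) \<phi> \<phi>s \<le> R_sub H G rho2 sigma2 lam (enat M) \<phi> \<phi>s"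
proof -
  interpret H: spectral_distribution H rmin rmax
    using assms by (simp add: spectral_distribution_def spectral_distribution_axioms_def)
  interpret G: spectral_distribution G rmin rmax
    using assms by (simp add: spectral_distribution_def spectral_distribution_axioms_def)
  note M = \<open>1 \<le> M\<close>
  have risk: "R_sub H G rho2 sigma2 lam m \<phi> \<phi>s \<le> R_sub H G rho2 sigma2 lam n \<phi> \<phi>s"
    if "B_sub H G rho2 lam m \<phi> \<phi>s \<le> B_sub H G rho2 lam n \<phi> \<phi>s"
      "V_sub H sigma2 lam m \<phi> \<phi>s \<le> V_sub H sigma2 lam n \<phi> \<phi>s" for m n
    unfolding R_sub_def using that by (intro add_mono) auto
  consider (infinite) "\<phi>s = \<infinity>"
    | (interpolating) \<theta> where "\<phi>s = ereal \<theta>" "\<phi> \<le> \<theta>" "0 < lam \<or> 1 < \<theta>"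
    | (threshold) "\<phi>s = 1" "lam = 0"
    | (least_squares) \<theta> where "\<phi>s = ereal \<theta>" "\<phi> \<le> \<theta>" "lam = 0" "\<theta> < 1"
  proof (cases \<phi>s)
    case (real \<theta>)
    then have "\<phi> \<le> \<theta>" using \<open>ereal \<phi> \<le> \<phi>s\<close> by simp
    then show thesis
      using that(2)[of \<theta>] that(3) that(4)[of \<theta>] real \<open>0 \<le> lam\<close>
      by (cases "0 < lam"; cases \<theta> "1 :: real" rule: linorder_cases) (auto simp: one_ereal_def)
  qed (use that \<open>ereal \<phi> \<le> \<phi>s\<close> in auto)
  then show ?thesis
  proof cases
    case infinite
    have B: "B_fun H G rho2 lam \<phi> \<phi>s \<le> B_fun H G rho2 lam \<phi>s \<phi>s"
      using infinite by (simp add: B_fun_def v_tilde_def)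
    have V: "V_fun H sigma2 lam \<phi> \<phi>s = ereal 0" "V_fun H sigma2 lam \<phi>s \<phi>s = ereal 0"
      using infinite by (simp_all add: V_fun_def v_tilde_def)
    show ?thesis
      using B_sub_decreasing[OF M B] V_sub_decreasing[OF M V order_refl] risk infinite by simp
  next
    case (interpolating \<theta>)
    have \<theta>: "0 < \<theta>" using interpolating \<open>0 < \<phi>\<close> by simp
    have notle: "\<not> (lam = 0 \<and> \<phi>s \<le> 1)" "\<not> (lam = 0 \<and> \<phi>s = 1)" "\<not> (lam = 0 \<and> \<phi>s < 1)"
      using interpolating by (auto simp: one_ereal_def)
    define w where "w \<eta> = v_tilde H lam (ereal \<eta>) \<phi>s" for \<eta>
    have w_less: "w \<phi> < w \<theta>" if "\<phi> < \<theta>"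
      unfolding w_def interpolating(1)
      using that \<theta> interpolating \<open>0 \<le> lam\<close> by (intro H.v_tilde_strict_mono) auto
    then have w_le: "w \<phi> \<le> w \<theta>" using \<open>\<phi> \<le> \<theta>\<close> by fastforce
    obtain v where "0 < v" "v_fp H lam \<phi>s = ereal v"
      using H.v_fp_fixed_point[of \<theta> lam] \<theta> interpolating \<open>0 \<le> lam\<close> by metis
    then have c: "0 < c_tilde H G lam \<phi>s" by (intro G.c_tilde_pos) simp
    have B_eq: "B_fun H G rho2 lam (ereal \<eta>) \<phi>s = rho2 * (1 + w \<eta>) * c_tilde H G lam \<phi>s" for \<eta>
      unfolding B_fun_def w_def using notle(1) by (simp only: if_False)
    have B: "B_fun H G rho2 lam \<phi> \<phi>s \<le> B_fun H G rho2 lam \<phi>s \<phi>s"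
    proof -
      have "rho2 * (1 + w \<phi>) * c_tilde H G lam \<phi>s \<le> rho2 * (1 + w \<theta>) * c_tilde H G lam \<phi>s"
        using w_le c \<open>0 \<le> rho2\<close> by (intro mult_right_mono mult_left_mono) auto
      then show ?thesis
        using B_eq[of \<phi>] B_eq[of \<theta>] unfolding interpolating(1) by simp
    qed
    have B_less: "B_fun H G rho2 lam \<phi> \<phi>s < B_fun H G rho2 lam \<phi>s \<phi>s" if "\<phi> < \<theta>" "0 < rho2"
      using B_eq[of \<phi>] B_eq[of \<theta>] w_less[OF that(1)] c that(2)
      unfolding interpolating(1) by simp
    have V: "V_fun H sigma2 lam \<phi> \<phi>s = ereal (sigma2 * w \<phi>)"
      "V_fun H sigma2 lam \<phi>s \<phi>s = ereal (sigma2 * w \<theta>)"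
      using notle interpolating by (auto simp: V_fun_def w_def)
    have V_le: "sigma2 * w \<phi> \<le> sigma2 * w \<theta>"
      using w_le \<open>0 \<le> sigma2\<close> by (rule mult_left_mono)
    have V_less: "sigma2 * w \<phi> < sigma2 * w \<theta>" if "\<phi> < \<theta>" "0 < sigma2"
      using w_less that by simp
    show ?thesis
      using B_sub_decreasing[OF M B] V_sub_decreasing[OF M V V_le] B_less V_less risk
        interpolating(1) by simp
  next
    case threshold
    have B: "B_fun H G rho2 lam \<phi> \<phi>s \<le> B_fun H G rho2 lam \<phi>s \<phi>s"
      using threshold by (simp add: B_fun_def)
    \<comment> \<open>Already a single bag contributes a positive multiple of an infinite variance.\<close>
    have V: "V_sub H sigma2 lam (enat m) \<phi> \<phi>s = \<infinity>" if "1 \<le> m" for m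
      using that threshold by (auto simp: V_sub_def V_fun_def)
    show ?thesis
      using B_sub_decreasing[OF M B] V[OF M] V[of "M + 1"] risk threshold by simp
  next
    case (least_squares \<theta>)
    have "\<phi>s < 1" using least_squares by (simp add: one_ereal_def)
    then have B: "B_fun H G rho2 lam \<phi> \<phi>s \<le> B_fun H G rho2 lam \<phi>s \<phi>s"
      by (simp add: B_fun_def least_squares(3) less_imp_le)
    have V: "V_fun H sigma2 lam \<phi> \<phi>s = ereal (sigma2 * (\<phi> / (1 - \<phi>)))"
      "V_fun H sigma2 lam \<phi>s \<phi>s = ereal (sigma2 * (\<theta> / (1 - \<theta>)))"
      using \<open>\<phi>s < 1\<close> least_squares by (auto simp: V_fun_def)
    have less: "\<phi> / (1 - \<phi>) < \<theta> / (1 - \<theta>)" if "\<phi> < \<theta>"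
      using that least_squares by (intro odds_strict_mono) auto
    then have "\<phi> / (1 - \<phi>) \<le> \<theta> / (1 - \<theta>)" using \<open>\<phi> \<le> \<theta>\<close> by fastforce
    then have V_le: "sigma2 * (\<phi> / (1 - \<phi>)) \<le> sigma2 * (\<theta> / (1 - \<theta>))"
      using \<open>0 \<le> sigma2\<close> by (rule mult_left_mono)
    have V_less: "sigma2 * (\<phi> / (1 - \<phi>)) < sigma2 * (\<theta> / (1 - \<theta>))" if "\<phi> < \<theta>" "0 < sigma2"
      using less[OF that(1)] that(2) by (rule mult_strict_left_mono)
    show ?thesis
      using B_sub_decreasing[OF M B] V_sub_decreasing[OF M V V_le] V_less risk least_squares(1)
        \<open>\<phi>s < 1\<close> least_squares(3) by (auto simp: not_less)
  qed
qed

end
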